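(* Let $\lambda$ be an integer and let $G$ be a graph of minimum degree $\delta$. Let $C$ be a longest cycle in $G$, and let $\overline{p}$ denote the length of a longest path in $G\setminus C$. If $$\min\{\lambda-2,\ \delta-\lambda\}\le \overline{p}\le \max\{\lambda-2,\ \delta-\lambda\},$$ then $|C|\ge \lambda(\delta-\lambda+2)$.
   Context: All graphs are finite, undirected, without loops or multiple edges; no connectivity assumption is made on $G$. $|C|$ is the number of edges of $C$. $G\setminus C$ denotes the graph obtained from $G$ by deleting the vertices of $C$. The length of a path is its number of edges (a single vertex is a path of length $0$). If $C$ is a Hamilton cycle, then $\overline{p}=-1$. *)

theory Defs
  imports "Graph_Theory.Digraph_Component"
begin

text \<open>
  Undirected finite simple graphs are symmetric loop-free digraphs without parallel arcs
  (locale \<^locale>\<open>graph\<close>): an edge is a pair of opposite arcs. Paths and cycles are lists of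
  arcs, so their length as a list is their number of edges.
\<close>

text \<open>Each edge at a vertex contributes exactly one outgoing arc.\<close>
definition min_degree :: "('a, 'b) pre_digraph \<Rightarrow> nat" where
  "min_degree G = Min (out_degree G ` verts G)"

text \<open>
  In a symmetric digraph, \<^const>\<open>pre_digraph.cycle\<close> also admits an edge traversed back and
  forth; the length bound excludes exactly these closed walks of length 2.
\<close>
definition ucycle :: "('a, 'b) pre_digraph \<Rightarrow> 'b awalk \<Rightarrow> bool" where
  "ucycle G C \<longleftrightarrow> pre_digraph.cycle G C \<and> 3 \<le> length C"

definition longest_cycle :: "('a, 'b) pre_digraph \<Rightarrow> 'b awalk \<Rightarrow> bool" where
  "longest_cycle G C \<longleftrightarrow> ucycle G C \<and> (\<forall>D. ucycle G D \<longrightarrow> length D \<le> length C)"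

text \<open>As a cycle is closed, its vertices are the tails of its arcs.\<close>
definition del_cycle :: "('a, 'b) pre_digraph \<Rightarrow> 'b awalk \<Rightarrow> ('a, 'b) pre_digraph" where
  "del_cycle G C = G \<restriction> (verts G - tail G ` set C)"

text \<open>
  The null graph, which is what remains after deleting a Hamilton cycle, has no path at all;
  its longest path length is \<open>-1\<close> by convention.
\<close>
definition longest_path_length :: "('a, 'b) pre_digraph \<Rightarrow> int" where
  "longest_path_length H =
    (if verts H = {} then - 1 else int (Max {length p | u p v. pre_digraph.apath H u p v}))"

end

theory Submission
  imports Defs
begin

text \<open>
  Let a longest path off \<open>C\<close> have \<open>p + 1\<close> vertices \<open>x\<^sub>0, \<dots>, x\<^sub>p\<close>. The
  inequality \<open>|C| \<ge> (p + 2) (\<delta> - p)\<close> holds without any condition on \<open>p\<close>; the theorem follows since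
  \<open>(p + 2) (\<delta> - p) - \<lambda> (\<delta> - \<lambda> + 2) = (p + 2 - \<lambda>) (\<delta> - \<lambda> - p)\<close>.

  Attach to each \<open>x\<^sub>i\<close> a possibly trivial path (a tail) off the longest path, all tails disjoint, with
  total length plus number of nontrivial tails maximal. The tips \<open>y\<^sub>i\<close> of the tails then have
  at most \<open>p (p + 1)\<close> neighbours outside \<open>C\<close> altogether, hence at least \<open>(p + 1) (\<delta> - p)\<close> on \<open>C\<close>.
  As \<open>y\<^sub>i\<close> and \<open>y\<^sub>j\<close> are joined off \<open>C\<close> by a path of length at least \<open>|i - j|\<close>, attachment
  vertices of \<open>y\<^sub>i\<close> and \<open>y\<^sub>j\<close> on \<open>C\<close> are at distance at least \<open>|i - j| + 2\<close>. Summing these gaps around \<open>C\<close>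
  gives \<open>|C| \<ge> m + d\<close>, with \<open>m\<close> attachment vertices receiving \<open>d \<le> m (p + 1)\<close> edges. If \<open>C\<close> is a
  Hamilton cycle, the inequality reads \<open>|C| \<ge> \<delta> + 1\<close>.
\<close>

section \<open>Paths and cycles as vertex lists over a symmetric irreflexive relation\<close>

lemma successively_glue:
  "successively E (q @ [y]) \<Longrightarrow> successively E (y # s) \<Longrightarrow> successively E (q @ y # s)"
  by (auto simp: successively_append_iff)

lemma successively_take: "successively E q \<Longrightarrow> successively E (take n q)"
  by (metis append_take_drop_id successively_append_iff)

lemma successively_drop: "successively E q \<Longrightarrow> successively E (drop n q)"
  by (metis append_take_drop_id successively_append_iff)

locale sym_irrefl =
  fixes E :: "'a \<Rightarrow> 'a \<Rightarrow> bool"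
  assumes sym: "E u v \<Longrightarrow> E v u"
    and irrefl: "\<not> E u u"
begin

text \<open>The empty list counts as a path: it is the longest one when \<open>W\<close> is empty,
  which is the case of a Hamilton cycle.\<close>

definition path_in :: "'a set \<Rightarrow> 'a list \<Rightarrow> bool" where
  "path_in W q \<longleftrightarrow> distinct q \<and> set q \<subseteq> W \<and> successively E q"

definition cyc :: "'a list \<Rightarrow> bool" where
  "cyc q \<longleftrightarrow> distinct q \<and> 3 \<le> length q \<and> successively E q \<and> E (last q) (hd q)"

lemma successively_rev_sym [simp]: "successively E (rev q) \<longleftrightarrow> successively E q"
proof -
  have "(\<lambda>x y. E y x) = E"
    using sym by blast
  with successively_rev[of E q] show ?thesis
    by metis
qed

end

section \<open>Disjoint routes leaving a longest path\<close>

locale longest_path = sym_irrefl E for E :: "'a \<Rightarrow> 'a \<Rightarrow> bool" +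
  fixes W :: "'a set" and xs :: "'a list"
  assumes finite_W: "finite W"
    and path_xs: "path_in W xs"
    and longest: "path_in W q \<Longrightarrow> length q \<le> length xs"
begin

lemma distinct_xs: "distinct xs" and xs_subset: "set xs \<subseteq> W" and successively_xs: "successively E xs"
  using path_xs by (auto simp: path_in_def)

text \<open>
  Leaving the longest path at position \<open>j\<close> along \<open>r j\<close> to \<open>y\<close>, and possibly returning at \<open>k\<close>, never
  gains length; hence the intervals of radius \<open>length (r j) + 1\<close> around the positions \<open>j\<close> are disjoint.
\<close>
lemma packing:
  assumes y: "y \<in> W - set xs"
    and S: "S \<subseteq> {..<length xs}"
    and r: "\<And>j. j \<in> S \<Longrightarrow> distinct (r j) \<and> set (r j) \<subseteq> W - set xs - {y}
      \<and> successively E (xs ! j # r j @ [y])"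
    and disj: "\<And>j k. j \<in> S \<Longrightarrow> k \<in> S \<Longrightarrow> j \<noteq> k \<Longrightarrow> set (r j) \<inter> set (r k) = {}"
  shows "2 * (\<Sum>j\<in>S. Suc (length (r j))) < length xs"
proof -
  define a where "a j = Suc (length (r j))" for j
  define I where "I j = {j - a j..<j + a j}" for j
  have S_less: "j < length xs" if "j \<in> S" for j
    using S that by auto
  have fin: "finite S"
    using S finite_subset by blast
  have r_rev: "successively E (y # rev (r j) @ [xs ! j])" if "j \<in> S" for j
  proof -
    have "successively E (rev (xs ! j # r j @ [y]))"
      using r[OF that] successively_rev_sym by blast
    then show ?thesis
      by simp
  qed
  have left: "a j \<le> j" if j: "j \<in> S" for j
  proof -
    have d: "drop j xs = xs ! j # drop (Suc j) xs"
      using S_less[OF j] by (simp add: Cons_nth_drop_Suc)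
    have "successively E (drop j xs)"
      by (rule successively_drop[OF successively_xs])
    then have "successively E (y # rev (r j) @ drop j xs)"
      using r_rev[OF j] d by (auto simp: successively_Cons successively_append_iff hd_append)
    moreover have "distinct (y # rev (r j) @ drop j xs)"
      using r[OF j] y distinct_xs set_drop_subset[of j xs] by auto
    ultimately have "path_in W (y # rev (r j) @ drop j xs)"
      using r[OF j] y xs_subset set_drop_subset[of j xs] by (auto simp: path_in_def)
    from longest[OF this] show ?thesis
      using S_less[OF j] by (simp add: a_def)
  qed
  have right: "j + a j < length xs" if j: "j \<in> S" for j
  proof -
    have d: "take (Suc j) xs = take j xs @ [xs ! j]"
      using S_less[OF j] by (simp add: take_Suc_conv_app_nth)
    have "successively E (take (Suc j) xs)"
      by (rule successively_take[OF successively_xs])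
    then have "successively E (take (Suc j) xs @ r j @ [y])"
      using r[OF j] d by (auto simp: successively_Cons successively_append_iff)
    moreover have "distinct (take (Suc j) xs @ r j @ [y])"
      using r[OF j] y distinct_xs set_take_subset[of "Suc j" xs] by auto
    ultimately have "path_in W (take (Suc j) xs @ r j @ [y])"
      using r[OF j] y xs_subset set_take_subset[of "Suc j" xs] by (auto simp: path_in_def)
    from longest[OF this] show ?thesis
      using S_less[OF j] by (simp add: a_def)
  qed
  \<comment> \<open>Going from \<open>j\<close> through \<open>y\<close> to \<open>k\<close>
    replaces the \<open>k - j - 1\<close> vertices in between by
    \<open>length (r j) + 1 + length (r k)\<close> others, that is, by
    \<open>a j + a k - 1\<close>.\<close>
  have sep: "a j + a k \<le> k - j" if j: "j \<in> S" and k: "k \<in> S" and jk: "j < k" for j k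
  proof -
    let ?q = "take (Suc j) xs @ r j @ (y # rev (r k) @ drop k xs)"
    have d1: "take (Suc j) xs = take j xs @ [xs ! j]"
      using S_less[OF j] by (simp add: take_Suc_conv_app_nth)
    have d2: "drop k xs = xs ! k # drop (Suc k) xs"
      using S_less[OF k] by (simp add: Cons_nth_drop_Suc)
    have "successively E (drop k xs)"
      by (rule successively_drop[OF successively_xs])
    then have s2: "successively E (y # rev (r k) @ drop k xs)"
      using r_rev[OF k] d2 by (auto simp: successively_Cons successively_append_iff hd_append)
    have "successively E (take (Suc j) xs)"
      by (rule successively_take[OF successively_xs])
    then have s1: "successively E (take (Suc j) xs @ r j @ [y])"
      using r[OF j] d1 by (auto simp: successively_Cons successively_append_iff)
    have "successively E ?q"
      using successively_glue[OF s1[folded append_assoc] s2] by simp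
    moreover have "set (take (Suc j) xs) \<inter> set (drop k xs) = {}"
      using jk by (intro set_take_disj_set_drop_if_distinct distinct_xs) auto
    then have "distinct ?q"
      using r[OF j] r[OF k] y disj[OF j k] jk distinct_xs set_take_subset[of "Suc j" xs]
        set_drop_subset[of k xs] by auto
    ultimately have "path_in W ?q"
      using r[OF j] r[OF k] y xs_subset set_take_subset[of "Suc j" xs] set_drop_subset[of k xs]
      by (auto simp: path_in_def)
    from longest[OF this] show ?thesis
      using S_less[OF k] jk by (simp add: a_def)
  qed
  \<comment> \<open>The intervals are half-open, so \<open>sep\<close> is just enough to keep them
    apart; by \<open>left\<close> the subtraction in \<open>I\<close> is not truncated.\<close>
  have disjI: "I j \<inter> I k = {}" if "j \<in> S" "k \<in> S" "j < k" for j k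
    using sep[OF that] left[OF that(2)] by (auto simp: I_def)
  have "(\<Sum>j\<in>S. card (I j)) = card (\<Union>j\<in>S. I j)"
  proof (rule card_UN_disjoint[symmetric])
    show "\<forall>i\<in>S. \<forall>j\<in>S. i \<noteq> j \<longrightarrow> I i \<inter> I j = {}"
      using disjI by (metis Int_commute linorder_neqE_nat)
  qed (auto simp: fin I_def)
  also have "\<dots> \<le> card {..<length xs - 1}"
  proof (rule card_mono)
    show "(\<Union>j\<in>S. I j) \<subseteq> {..<length xs - 1}"
      using right by (fastforce simp: I_def)
  qed simp
  finally have "(\<Sum>j\<in>S. card (I j)) \<le> length xs - 1"
    by simp
  moreover have "card (I j) = 2 * a j" if "j \<in> S" for j
    using left[OF that] by (simp add: I_def)
  \<comment> \<open>The one-vertex path \<open>[y]\<close> shows that \<open>xs\<close> is nonempty,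
    which makes the bound by \<open>length xs - 1\<close> strict.\<close>
  moreover have "length [y] \<le> length xs"
    using y by (intro longest) (auto simp: path_in_def)
  ultimately show ?thesis
    by (simp add: a_def sum_distrib_left)
qed

section \<open>Disjoint tails of maximal weight and the neighbours of their tips\<close>

definition tails :: "(nat \<Rightarrow> 'a list) \<Rightarrow> bool" where
  "tails T \<longleftrightarrow> (\<forall>i<length xs. distinct (T i) \<and> set (T i) \<subseteq> W - set xs \<and> successively E (xs ! i # T i))
    \<and> (\<forall>i<length xs. \<forall>j<length xs. i \<noteq> j \<longrightarrow> set (T i) \<inter> set (T j) = {})"

text \<open>The extra 1 makes it profitable to hand part of a tail over to a position whose tail is
  empty.\<close>

definition weight :: "(nat \<Rightarrow> 'a list) \<Rightarrow> nat" where
  "weight T = (\<Sum>i<length xs. length (T i) + (if T i = [] then 0 else 1))"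

definition tip :: "(nat \<Rightarrow> 'a list) \<Rightarrow> nat \<Rightarrow> 'a" where
  "tip T i = last (xs ! i # T i)"

text \<open>Contributions are added on both sides because subtraction of naturals truncates.\<close>

lemma weight_upd:
  assumes "i < length xs"
  shows "weight (T(i := t)) + (length (T i) + (if T i = [] then 0 else 1))
    = weight T + (length t + (if t = [] then 0 else 1))"
  using assms by (simp add: weight_def sum.remove[of "{..<length xs}" i])

lemma tailsD:
  assumes "tails T" "i < length xs"
  shows "distinct (T i)" "set (T i) \<subseteq> W - set xs" "successively E (xs ! i # T i)"
    "j < length xs \<Longrightarrow> i \<noteq> j \<Longrightarrow> set (T i) \<inter> set (T j) = {}"
  using assms unfolding tails_def by blast+

text \<open>Weights are bounded: a tail weighs at most twice its number of vertices, and disjoint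
  tails in \<open>W\<close> have at most \<open>card W\<close> vertices altogether.\<close>

lemma ex_max_tails: "\<exists>T. tails T \<and> (\<forall>T'. tails T' \<longrightarrow> weight T' \<le> weight T)"
proof (rule ex_has_greatest_nat)
  show "tails (\<lambda>_. [])"
    by (simp add: tails_def)
  show "\<forall>T. tails T \<longrightarrow> weight T < Suc (2 * card W)"
  proof (intro allI impI)
    fix T assume T: "tails T"
    have "weight T \<le> (\<Sum>i<length xs. 2 * card (set (T i)))"
      unfolding weight_def
    proof (rule sum_mono)
      fix i assume "i \<in> {..<length xs}"
      then have "distinct (T i)"
        using T by (auto simp: tails_def)
      then show "length (T i) + (if T i = [] then 0 else 1) \<le> 2 * card (set (T i))"
        by (cases "T i") (auto simp: distinct_card)
    qed
    also have "\<dots> = 2 * card (\<Union>i<length xs. set (T i))"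
      using T by (subst card_UN_disjoint) (auto simp: tails_def sum_distrib_left)
    also have "card (\<Union>i<length xs. set (T i)) \<le> card W"
      using T finite_W by (intro card_mono) (auto simp: tails_def)
    finally show "weight T < Suc (2 * card W)"
      by simp
  qed
qed

context
  fixes T
  assumes T: "tails T" and max: "\<And>T'. tails T' \<Longrightarrow> weight T' \<le> weight T"
begin

text \<open>Otherwise \<open>u\<close> could be appended to tail \<open>i\<close>, raising the
  weight.\<close>

lemma tip_neighbour_in_tail:
  assumes i: "i < length xs" and E: "E (tip T i) u" and u: "u \<in> W - set xs"
  shows "\<exists>j<length xs. u \<in> set (T j)"
proof (rule ccontr)
  assume neg: "\<not> (\<exists>j<length xs. u \<in> set (T j))"
  have "successively E ((xs ! i # T i) @ [u])"
    using tailsD(3)[OF T i] E by (subst successively_append_iff) (auto simp: tip_def)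
  then have "tails (T(i := T i @ [u]))"
    using T u neg i by (auto simp: tails_def)
  from max[OF this] weight_upd[OF i, of T "T i @ [u]"] show False
    by (auto split: if_splits)
qed

lemma neighbour_in_tail_eq_hd:
  assumes i: "i < length xs" "T i = []" and j: "j < length xs"
    and E: "E (xs ! i) u" and u: "u \<in> set (T j)"
  shows "u = hd (T j)"
proof (rule ccontr)
  assume neq: "u \<noteq> hd (T j)"
  obtain A B where AB: "T j = A @ u # B"
    using u split_list by metis
  \<comment> \<open>Tail \<open>j\<close> thus stays nonempty after the cut below; for
    \<open>A = []\<close> the exchange would gain nothing.\<close>
  with neq have A: "A \<noteq> []"
    by auto
  have ij: "i \<noteq> j"
    using i u by auto
  \<comment> \<open>Handing the end of tail \<open>j\<close>, from \<open>u\<close> on, over to \<open>i\<close> keeps the total length and makes one more tail nonempty.\<close>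
  let ?T = "(T(j := A))(i := u # B)"
  have "tails ?T"
    unfolding tails_def
  proof (intro conjI allI impI)
    fix k assume k: "k < length xs"
    show "distinct (?T k)" "set (?T k) \<subseteq> W - set xs"
      using tailsD(1,2)[OF T k] tailsD(1,2)[OF T j] AB by auto
    have "successively E (xs ! j # A @ u # B)"
      using tailsD(3)[OF T j] AB by simp
    then show "successively E (xs ! k # ?T k)"
      using tailsD(3)[OF T k] E by (auto simp: successively_append_iff successively_Cons A)
  next
    fix k l assume kl: "k < length xs" "l < length xs" "k \<noteq> l"
    have "distinct (A @ u # B)"
      using tailsD(1)[OF T j] AB by simp
    moreover have "set (T l) \<inter> set (A @ u # B) = {}" if "l \<noteq> j"
      using tailsD(4)[OF T j kl(2)] that AB by (metis Int_commute)
    moreover have "set (T k) \<inter> set (A @ u # B) = {}" if "k \<noteq> j"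
      using tailsD(4)[OF T j kl(1)] that AB by (metis Int_commute)
    moreover have "set (T k) \<inter> set (T l) = {}"
      using tailsD(4)[OF T kl(1,2)] kl(3) by blast
    ultimately show "set (?T k) \<inter> set (?T l) = {}"
      using kl ij by auto
  qed
  from max[OF this] weight_upd[OF j, of T A] weight_upd[OF i(1), of "T(j := A)" "u # B"] show False
    using i ij AB A by auto
qed

text \<open>All neighbours in \<open>W\<close> lie on disjoint routes from positions of
  \<open>xs\<close> to the tip. \<open>packing\<close> bounds the number of vertices of these
  routes, and with it the number of neighbours.\<close>

lemma card_nbrs_tip_nonempty:
  assumes i: "i < length xs" and ne: "T i \<noteq> []"
  shows "2 * card {u \<in> W. E (tip T i) u} < length xs"
proof -
  define y where "y = tip T i"
  define N where "N = {u \<in> W. E y u}"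
  \<comment> \<open>The tip is removed from its own tail: it is the common end of the routes, so
    none may pass through it.\<close>
  define Q where "Q j = (if j = i then butlast (T i) else T j)" for j
  have y_last: "y = last (T i)"
    using ne by (simp add: y_def tip_def)
  have Ti: "T i = butlast (T i) @ [y]"
    using ne y_last by simp
  have yW: "y \<in> W - set xs"
    using tailsD(2)[OF T i] ne y_last last_in_set by blast
  have Q_sub: "set (Q j) \<subseteq> set (T j)" for j
    by (auto simp: Q_def dest: in_set_butlastD)
  have Q: "distinct (Q j) \<and> set (Q j) \<subseteq> W - set xs - {y} \<and> successively E (xs ! j # Q j)"
    if j: "j < length xs" for j
  proof (cases "j = i")
    case True
    have d: "distinct (butlast (T i) @ [y])" and "successively E ((xs ! i # butlast (T i)) @ [y])"
      using tailsD[OF T i] Ti by auto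
    then have "successively E (xs ! i # butlast (T i))"
      unfolding successively_append_iff by blast
    moreover have "distinct (butlast (T i))" "y \<notin> set (butlast (T i))"
      using d by auto
    moreover have "set (butlast (T i)) \<subseteq> W - set xs"
      using tailsD(2)[OF T i] in_set_butlastD by fast
    moreover have Qi: "Q i = butlast (T i)"
      by (simp add: Q_def)
    ultimately show ?thesis
      unfolding True Qi by blast
  next
    case False
    have "y \<in> set (T i)"
      using ne y_last by simp
    then have "y \<notin> set (T j)"
      using tailsD(4)[OF T i j] False by auto
    then show ?thesis
      using tailsD(1-3)[OF T j] False by (auto simp: Q_def)
  qed
  have cover: "u \<in> (\<Union>j<length xs. set (xs ! j # Q j))" if u: "u \<in> N" for u
  proof (cases "u \<in> set xs")
    case True
    then show ?thesis
      by (auto simp: in_set_conv_nth)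
  next
    case False
    then obtain j where j: "j < length xs" "u \<in> set (T j)"
      using tip_neighbour_in_tail[OF i, of u] u by (auto simp: N_def y_def)
    moreover have "u \<noteq> y"
      using u irrefl by (auto simp: N_def)
    moreover have "set (T i) = insert y (set (butlast (T i)))"
      by (subst Ti) simp
    ultimately have "u \<in> set (Q j)"
      by (cases "j = i") (simp_all add: Q_def)
    then show ?thesis
      using j by auto
  qed
  \<comment> \<open>Cut each tail after its last neighbour of \<open>y\<close>; the cut tails reach \<open>y\<close>, so \<open>packing\<close> applies.\<close>
  define S where "S = {j. j < length xs \<and> N \<inter> set (xs ! j # Q j) \<noteq> {}}"
  have "\<forall>j\<in>S. \<exists>s B. Q j = s @ B \<and> last (xs ! j # s) \<in> N \<and> N \<inter> set B = {}"
  proof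
    fix j assume "j \<in> S"
    then have "\<exists>u\<in>set (xs ! j # Q j). u \<in> N"
      by (auto simp: S_def)
    from split_list_last_prop[OF this]
    obtain A u B where d: "xs ! j # Q j = A @ u # B" "u \<in> N" "\<forall>z\<in>set B. z \<notin> N"
      by blast
    have "Q j = tl (A @ [u]) @ B"
      using d(1) by (cases A) auto
    moreover have "last (xs ! j # tl (A @ [u])) = u"
      using d(1) by (cases A) auto
    moreover have "N \<inter> set B = {}"
      using d(3) by blast
    ultimately show "\<exists>s B. Q j = s @ B \<and> last (xs ! j # s) \<in> N \<and> N \<inter> set B = {}"
      using d(2) by (intro exI[of _ "tl (A @ [u])"] exI[of _ B]) simp
  qed
  then obtain r B where rB: "\<And>j. j \<in> S \<Longrightarrow> Q j = r j @ B j"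
    "\<And>j. j \<in> S \<Longrightarrow> last (xs ! j # r j) \<in> N" "\<And>j. j \<in> S \<Longrightarrow> N \<inter> set (B j) = {}"
    by metis
  have S: "S \<subseteq> {..<length xs}"
    by (auto simp: S_def)
  have "2 * (\<Sum>j\<in>S. Suc (length (r j))) < length xs"
  proof (rule packing[OF yW S])
    fix j assume j: "j \<in> S"
    then have "j < length xs"
      using S by auto
    note q = Q[OF this]
    have "successively E ((xs ! j # r j) @ B j)"
      using q rB(1)[OF j] by simp
    then have "successively E (xs ! j # r j)"
      unfolding successively_append_iff by blast
    moreover have "E (last (xs ! j # r j)) y"
      using rB(2)[OF j] sym by (simp add: N_def)
    ultimately have "successively E ((xs ! j # r j) @ [y])"
      by (subst successively_append_iff) auto
    then show "distinct (r j) \<and> set (r j) \<subseteq> W - set xs - {y} \<and> successively E (xs ! j # r j @ [y])"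
      using q rB(1)[OF j] by auto
  next
    fix j k assume jk: "j \<in> S" "k \<in> S" "j \<noteq> k"
    have "set (T j) \<inter> set (T k) = {}"
      using tailsD(4)[OF T] S jk by blast
    then show "set (r j) \<inter> set (r k) = {}"
      using Q_sub[of j] Q_sub[of k] rB(1)[OF jk(1)] rB(1)[OF jk(2)] by auto
  qed
  moreover have "card N \<le> card (\<Union>j\<in>S. set (xs ! j # r j))"
  proof (rule card_mono)
    show "finite (\<Union>j\<in>S. set (xs ! j # r j))"
      using S finite_subset by blast
    show "N \<subseteq> (\<Union>j\<in>S. set (xs ! j # r j))"
    proof
      fix u assume u: "u \<in> N"
      then obtain j where j: "j < length xs" "u \<in> set (xs ! j # Q j)"
        using cover by blast
      then have jS: "j \<in> S"
        using u by (auto simp: S_def)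
      then have "u \<in> set (xs ! j # r j)"
        using j(2) u rB(1,3)[OF jS] by auto
      then show "u \<in> (\<Union>j\<in>S. set (xs ! j # r j))"
        using jS by blast
    qed
  qed
  moreover have "card (\<Union>j\<in>S. set (xs ! j # r j)) \<le> (\<Sum>j\<in>S. card (set (xs ! j # r j)))"
    using S finite_subset by (intro card_UN_le) blast
  moreover have "\<dots> \<le> (\<Sum>j\<in>S. Suc (length (r j)))"
    by (intro sum_mono) (metis card_length length_Cons)
  ultimately show ?thesis
    by (simp add: N_def y_def)
qed

text \<open>The head of tail \<open>j\<close> is adjacent to every counted position and to
  \<open>xs ! j\<close> itself, hence the \<open>Suc\<close>. These routes are single edges, so
  \<open>packing\<close> applies with empty lists.\<close>

lemma card_empty_attached:
  assumes j: "j < length xs" and ne: "T j \<noteq> []"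
  shows "2 * Suc (card {i. i < length xs \<and> T i = [] \<and> E (xs ! i) (hd (T j))}) < length xs"
proof -
  let ?A = "{i. i < length xs \<and> T i = [] \<and> E (xs ! i) (hd (T j))}"
  have "2 * (\<Sum>i\<in>insert j ?A. Suc (length ([] :: 'a list))) < length xs"
  proof (rule packing)
    show "hd (T j) \<in> W - set xs"
      using tailsD(2)[OF T j] ne hd_in_set by blast
    fix k assume "k \<in> insert j ?A"
    moreover have "E (xs ! j) (hd (T j))"
      using tailsD(3)[OF T j] ne by (simp add: successively_Cons)
    ultimately show "distinct [] \<and> set [] \<subseteq> W - set xs - {hd (T j)}
        \<and> successively E (xs ! k # [] @ [hd (T j)])"
      by auto
  qed (use j in auto)
  moreover have "j \<notin> ?A"
    using ne by simp
  ultimately show ?thesis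
    by simp
qed

text \<open>Off \<open>xs\<close>, such a tip has neighbours only at heads of tails. This excess
  over \<open>length xs - 1\<close> is balanced against the nonempty tails in
  \<open>sum_card_nbrs_tips\<close>.\<close>

lemma card_nbrs_tip_empty:
  assumes i: "i < length xs" and em: "T i = []"
  shows "card {u \<in> W. E (tip T i) u}
    \<le> (length xs - 1) + card {j. j < length xs \<and> T j \<noteq> [] \<and> E (xs ! i) (hd (T j))}"
proof -
  let ?B = "{j. j < length xs \<and> T j \<noteq> [] \<and> E (xs ! i) (hd (T j))}"
  have tip: "tip T i = xs ! i"
    by (simp add: tip_def em)
  have "{u \<in> W. E (tip T i) u} \<subseteq> (set xs - {xs ! i}) \<union> (\<lambda>j. hd (T j)) ` ?B"
  proof
    fix u assume u: "u \<in> {u \<in> W. E (tip T i) u}"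
    show "u \<in> (set xs - {xs ! i}) \<union> (\<lambda>j. hd (T j)) ` ?B"
    proof (cases "u \<in> set xs")
      case True
      then show ?thesis
        using u irrefl tip by auto
    next
      case False
      then obtain j where j: "j < length xs" "u \<in> set (T j)"
        using tip_neighbour_in_tail[OF i, of u] u by auto
      then have "u = hd (T j)"
        using neighbour_in_tail_eq_hd[OF i em j(1)] u tip by auto
      then have "j \<in> ?B"
        using j u tip by auto
      then show ?thesis
        using \<open>u = hd (T j)\<close> by blast
    qed
  qed
  then have "card {u \<in> W. E (tip T i) u} \<le> card ((set xs - {xs ! i}) \<union> (\<lambda>j. hd (T j)) ` ?B)"
    by (intro card_mono) auto
  also have "\<dots> \<le> card (set xs - {xs ! i}) + card ((\<lambda>j. hd (T j)) ` ?B)"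
    by (rule card_Un_le)
  also have "card (set xs - {xs ! i}) = length xs - 1"
    using i distinct_xs by (simp add: card_Diff_singleton distinct_card)
  also have "card ((\<lambda>j. hd (T j)) ` ?B) \<le> card ?B"
    by (intro card_image_le) simp
  finally show ?thesis
    by simp
qed

text \<open>Only edges from tips of empty tails to heads of nonempty ones can push a count above
  \<open>length xs - 1\<close>. Counted from the other end, a nonempty tail receives fewer than
  \<open>length xs / 2\<close> of them, and its own tip has fewer than \<open>length xs / 2\<close>
  neighbours in \<open>W\<close>, so its share absorbs both.\<close>

lemma sum_card_nbrs_tips:
  "(\<Sum>i<length xs. card {u \<in> W. E (tip T i) u}) \<le> length xs * (length xs - 1)"
proof -
  let ?P = "length xs"
  define Z where "Z = {i. i < ?P \<and> T i = []}"
  define N where "N = {i. i < ?P \<and> T i \<noteq> []}"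
  define h where "h i = card {u \<in> W. E (tip T i) u}" for i
  have split: "{..<?P} = Z \<union> N" and disj: "Z \<inter> N = {}" and fin: "finite Z" "finite N"
    by (auto simp: Z_def N_def)
  have "(\<Sum>i\<in>Z. h i) \<le> (\<Sum>i\<in>Z. (?P - 1) + card {j \<in> N. E (xs ! i) (hd (T j))})"
  proof (rule sum_mono)
    fix i assume "i \<in> Z"
    then show "h i \<le> (?P - 1) + card {j \<in> N. E (xs ! i) (hd (T j))}"
      using card_nbrs_tip_empty[of i] by (simp add: Z_def N_def h_def conj_assoc)
  qed
  also have "\<dots> = card Z * (?P - 1) + (\<Sum>i\<in>Z. card {j \<in> N. E (xs ! i) (hd (T j))})"
    by (simp add: sum.distrib)
  also have "(\<Sum>i\<in>Z. card {j \<in> N. E (xs ! i) (hd (T j))})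
      = (\<Sum>j\<in>N. card {i \<in> Z. E (xs ! i) (hd (T j))})"
    using sum.swap_restrict[OF fin, of "\<lambda>_ _. 1::nat" "\<lambda>i j. E (xs ! i) (hd (T j))"] by simp
  finally have Zsum: "(\<Sum>i\<in>Z. h i)
      \<le> card Z * (?P - 1) + (\<Sum>j\<in>N. card {i \<in> Z. E (xs ! i) (hd (T j))})" .
  have "(\<Sum>j\<in>N. h j) + (\<Sum>j\<in>N. card {i \<in> Z. E (xs ! i) (hd (T j))}) \<le> (\<Sum>j\<in>N. ?P - 1)"
    unfolding sum.distrib[symmetric]
  proof (rule sum_mono)
    fix j assume "j \<in> N"
    then show "h j + card {i \<in> Z. E (xs ! i) (hd (T j))} \<le> ?P - 1"
      using card_nbrs_tip_nonempty[of j] card_empty_attached[of j]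
      by (simp add: N_def Z_def h_def conj_assoc)
  qed
  then have "(\<Sum>j\<in>N. h j) + (\<Sum>j\<in>N. card {i \<in> Z. E (xs ! i) (hd (T j))}) \<le> card N * (?P - 1)"
    by simp
  moreover have "(\<Sum>i<?P. h i) = (\<Sum>i\<in>Z. h i) + (\<Sum>i\<in>N. h i)"
    unfolding split by (rule sum.union_disjoint[OF fin disj])
  ultimately have "(\<Sum>i<?P. h i) \<le> card Z * (?P - 1) + card N * (?P - 1)"
    using Zsum by linarith
  also have "\<dots> = (card Z + card N) * (?P - 1)"
    by (simp add: add_mult_distrib)
  also have "card Z + card N = ?P"
    using card_Un_disjoint[OF fin disj] split by (metis card_lessThan)
  finally show ?thesis
    by (simp add: h_def)
qed

end

end

section \<open>Summing gaps between positions on a line\<close>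

text \<open>The gaps telescope: a new maximum \<open>b\<close> extends the range by at least
  \<open>2 + hi (Max M) - lo b\<close>. The summand \<open>2 + hi (Max M) - lo (Min M)\<close> on
  the right is left for the gap that closes the cycle.\<close>

lemma sum_gaps_le:
  fixes lo hi :: "nat \<Rightarrow> int"
  assumes "finite M" "M \<noteq> {}"
    and "\<And>v w. v \<in> M \<Longrightarrow> w \<in> M \<Longrightarrow> v < w \<Longrightarrow> 2 + hi v - lo w \<le> int w - int v"
  shows "(\<Sum>v\<in>M. 2 + hi v - lo v) \<le> int (Max M) - int (Min M) + 2 + hi (Max M) - lo (Min M)"
  using assms
proof (induction M rule: finite_linorder_max_induct)
  case empty
  then show ?case by simp
next
  case (insert b M)
  show ?case
  proof (cases "M = {}")
    case True
    then show ?thesis by simp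
  next
    case False
    have b: "b \<notin> M" "Max M < b" "Min M < b"
      using insert.hyps False by auto
    have "(\<Sum>v\<in>M. 2 + hi v - lo v) \<le> int (Max M) - int (Min M) + 2 + hi (Max M) - lo (Min M)"
      using insert.IH False insert.prems by blast
    moreover have "2 + hi (Max M) - lo b \<le> int b - int (Max M)"
      using insert.prems(2)[of "Max M" b] Max_in[OF insert.hyps(1) False] b by blast
    moreover have "Max (insert b M) = b" "Min (insert b M) = Min M"
      using insert.hyps(1) False b(2,3) by (simp_all add: max_absorb1 min_absorb2 del: Max_less_iff Min_less_iff)
    moreover have "(\<Sum>v\<in>insert b M. 2 + hi v - lo v) = (2 + hi b - lo b) + (\<Sum>v\<in>M. 2 + hi v - lo v)"
      using insert.hyps(1) b(1) by simp
    ultimately show ?thesis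
      by simp
  qed
qed

section \<open>Paths joining two tips\<close>

context longest_path
begin

lemma tip_in_W:
  assumes "tails T" "i < length xs"
  shows "tip T i \<in> W"
proof -
  have "tip T i \<in> insert (xs ! i) (set (T i))"
    unfolding tip_def by (metis last_in_set list.distinct(1) list.simps(15))
  then show ?thesis
    using tailsD(2)[OF assms] xs_subset nth_mem[OF assms(2)] by auto
qed

text \<open>The path runs back along tail \<open>i\<close>, along \<open>xs\<close> from
  \<open>i\<close> to \<open>j\<close>, and out along tail \<open>j\<close>. Lengths count vertices;
  the middle part alone has \<open>Suc (j - i)\<close>.\<close>

lemma ex_tip_path_less:
  assumes T: "tails T" and ij: "i < j" and j: "j < length xs"
  shows "\<exists>q. path_in W q \<and> q \<noteq> [] \<and> hd q = tip T i \<and> last q = tip T j \<and> Suc (j - i) \<le> length q"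
proof -
  define M where "M = drop i (take (Suc j) xs)"
  let ?q = "rev (T i) @ M @ T j"
  have i: "i < length xs"
    using ij j by simp
  have M1: "M = xs ! i # drop (Suc i) (take (Suc j) xs)"
    using ij j by (simp add: M_def Cons_nth_drop_Suc[symmetric])
  have M2: "M = drop i (take j xs) @ [xs ! j]"
    using ij j by (simp add: M_def take_Suc_conv_app_nth)
  have M_sub: "set M \<subseteq> set xs"
    unfolding M_def by (meson in_set_dropD in_set_takeD subsetI)
  have sM: "successively E M"
    unfolding M_def by (intro successively_drop successively_take successively_xs)
  have "successively E (M @ T j)"
  proof (cases "T j = []")
    case False
    then show ?thesis
      using tailsD(3)[OF T j] sM M2 by (simp add: successively_append_iff successively_Cons)
  qed (simp add: sM)
  moreover have "successively E (rev (T i) @ [xs ! i])"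
    using tailsD(3)[OF T i] successively_rev_sym[of "xs ! i # T i"] by simp
  ultimately have "successively E ?q"
    unfolding M1 append_Cons by (rule successively_glue[rotated])
  moreover have "distinct ?q"
  proof -
    have "set (T i) \<inter> set (T j) = {}"
      using tailsD(4)[OF T i j] ij by blast
    moreover have "set (T i) \<inter> set M = {}" "set (T j) \<inter> set M = {}"
      using tailsD(2)[OF T i] tailsD(2)[OF T j] M_sub by blast+
    moreover have "distinct M"
      using distinct_xs by (simp add: M_def)
    ultimately show ?thesis
      using tailsD(1)[OF T i] tailsD(1)[OF T j] by auto
  qed
  moreover have "set ?q \<subseteq> W"
    using tailsD(2)[OF T i] tailsD(2)[OF T j] M_sub xs_subset by auto
  ultimately have "path_in W ?q"
    by (simp add: path_in_def)
  moreover have "hd ?q = tip T i"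
    by (cases "T i" rule: rev_cases) (simp_all add: M1 tip_def)
  moreover have "last ?q = tip T j"
    by (simp add: M2 tip_def)
  moreover have "?q \<noteq> []" "Suc (j - i) \<le> length ?q"
    using ij j by (auto simp: M_def)
  ultimately show ?thesis
    by blast
qed

lemma ex_tip_path:
  assumes T: "tails T" and i: "i < length xs" and j: "j < length xs"
  shows "\<exists>q. path_in W q \<and> q \<noteq> [] \<and> hd q = tip T i \<and> last q = tip T j
    \<and> 1 + \<bar>int i - int j\<bar> \<le> int (length q)"
proof (cases i j rule: linorder_cases)
  case less
  then show ?thesis
    using ex_tip_path_less[OF T less j] by force
next
  case equal
  then show ?thesis
    using tip_in_W[OF T i] by (intro exI[of _ "[tip T i]"]) (simp add: path_in_def)
next
  case greater
  then obtain q where "path_in W q" "q \<noteq> []" "hd q = tip T j" "last q = tip T i" "Suc (i - j) \<le> length q"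
    using ex_tip_path_less[OF T greater i] by blast
  then show ?thesis
    using greater successively_rev_sym[of q]
    by (intro exI[of _ "rev q"]) (simp add: path_in_def hd_rev last_rev del: successively_rev)
qed

end

section \<open>Rerouting a longest cycle through paths off it\<close>

locale longest_cycle_path = longest_path E W xs for E :: "'a \<Rightarrow> 'a \<Rightarrow> bool" and W xs +
  fixes cs :: "'a list"
  assumes cyc_cs: "cyc cs"
    and longest_cyc: "cyc q \<Longrightarrow> length q \<le> length cs"
    and disjoint: "W \<inter> set cs = {}"
begin

text \<open>Either arc of the cycle between the two positions can be replaced by the detour through
  \<open>q\<close>, which has \<open>Suc (length q)\<close> edges. The result is again a cycle, so
  neither arc is shorter than the detour.\<close>

lemma bypass:
  assumes q: "path_in W q" "q \<noteq> []" and vw: "v < w" and w: "w < length cs"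
    and E: "E (cs ! v) (hd q)" "E (cs ! w) (last q)"
  shows "Suc (length q) \<le> w - v" "Suc (length q) \<le> length cs - (w - v)"
proof -
  have cs: "distinct cs" "successively E cs" "E (last cs) (hd cs)" "cs \<noteq> []"
    using cyc_cs by (auto simp: cyc_def)
  have qs: "distinct q" "set q \<subseteq> W" "successively E q"
    using q by (auto simp: path_in_def)
  define B where "B = drop w cs"
  define A where "A = take (Suc v) cs"
  define M where "M = drop v (take (Suc w) cs)"
  have B: "B \<noteq> []" "hd B = cs ! w" "last B = last cs"
    using w by (auto simp: B_def hd_drop_conv_nth)
  have A: "A \<noteq> []" "hd A = hd cs" "last A = cs ! v"
    using vw w cs(4) by (simp_all add: A_def last_conv_nth)
  have M: "M \<noteq> []" "hd M = cs ! v" "last M = cs ! w"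
    using vw w by (auto simp: M_def hd_drop_conv_nth last_drop take_Suc_conv_app_nth)
  have sub: "set A \<subseteq> set cs" "set B \<subseteq> set cs" "set M \<subseteq> set cs"
    unfolding A_def B_def M_def by (meson in_set_dropD in_set_takeD subsetI)+
  have AB: "set A \<inter> set B = {}"
    unfolding A_def B_def using vw by (intro set_take_disj_set_drop_if_distinct cs(1)) simp
  have s: "successively E A" "successively E B" "successively E M"
    unfolding A_def B_def M_def by (intro successively_drop successively_take cs(2))+
  have d: "distinct A" "distinct B" "distinct M"
    using cs(1) by (simp_all add: A_def B_def M_def)
  have lq: "1 \<le> length q"
    using q(2) by (cases q) auto
  have l: "length A = Suc v" "length B = length cs - w" "length M = Suc w - v"
    using vw w by (simp_all add: A_def B_def M_def)
  \<comment> \<open>The arc from \<open>v\<close> up to \<open>w\<close> is dropped; the closing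
    edge of \<open>cs\<close> joins \<open>B\<close> to \<open>A\<close>.\<close>
  have "cyc (q @ B @ A)"
    unfolding cyc_def
  proof (intro conjI)
    show "distinct (q @ B @ A)"
      using qs d AB sub disjoint by auto
    show "3 \<le> length (q @ B @ A)"
      using l lq vw w by simp
    have "successively E (B @ A)"
      using s A B cs(3) by (simp add: successively_append_iff)
    then show "successively E (q @ B @ A)"
      using qs(3) B E(2) sym by (simp add: successively_append_iff)
    show "E (last (q @ B @ A)) (hd (q @ B @ A))"
      using q(2) A E(1) by simp
  qed
  from longest_cyc[OF this] show "Suc (length q) \<le> w - v"
    using l vw w by simp
  have "cyc (q @ rev M)"
    unfolding cyc_def
  proof (intro conjI)
    show "distinct (q @ rev M)"
      using qs d sub disjoint by auto
    show "3 \<le> length (q @ rev M)"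
      using l lq vw w by simp
    have "E (last q) (hd (rev M))"
      using M E(2) sym by (simp add: hd_rev)
    then show "successively E (q @ rev M)"
      using qs(3) s(3) successively_rev_sym[of M] unfolding successively_append_iff by blast
    show "E (last (q @ rev M)) (hd (q @ rev M))"
      using q(2) M E(1) by (simp add: last_rev)
  qed
  from longest_cyc[OF this] show "Suc (length q) \<le> length cs - (w - v)"
    using l vw w by simp
qed

text \<open>With at least two vertices, \<open>q\<close> and the vertex at \<open>v\<close> form a
  cycle; otherwise the bound is at most 2, and a cycle has length at least 3.\<close>

lemma detour_single:
  assumes q: "path_in W q" "q \<noteq> []" and v: "v < length cs"
    and E: "E (cs ! v) (hd q)" "E (cs ! v) (last q)"
  shows "Suc (length q) \<le> length cs"
proof (cases "2 \<le> length q")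
  case True
  have "cs ! v \<notin> set q"
    using q(1) disjoint v nth_mem[OF v] by (auto simp: path_in_def)
  then have "cyc (cs ! v # q)"
    using q True E sym by (auto simp: cyc_def path_in_def successively_Cons)
  from longest_cyc[OF this] show ?thesis
    by simp
next
  case False
  then show ?thesis
    using cyc_cs by (simp add: cyc_def)
qed

text \<open>The gap from an attachment \<open>v\<close> to the next one \<open>w\<close> is at least
  \<open>2 + hi v - lo w\<close>. Around the cycle this amounts to \<open>2 + hi v - lo v\<close>
  per attachment, and \<open>c v\<close> lies in an interval of \<open>hi v - lo v + 1\<close>
  indices.\<close>

lemma cycle_length_ge_attachments:
  assumes T: "tails T"
  defines "c \<equiv> \<lambda>v. {i. i < length xs \<and> E (cs ! v) (tip T i)}"
  defines "M \<equiv> {v. v < length cs \<and> c v \<noteq> {}}"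
  shows "card M + (\<Sum>v\<in>M. card (c v)) \<le> length cs"
proof (cases "M = {}")
  case False
  define lo where "lo v = int (Min (c v))" for v
  define hi where "hi v = int (Max (c v))" for v
  have fin_c: "finite (c v)" for v
    by (simp add: c_def)
  have fin_M: "finite M"
    by (simp add: M_def)
  have path: "\<exists>q. path_in W q \<and> q \<noteq> [] \<and> E (cs ! v) (hd q) \<and> E (cs ! w) (last q)
      \<and> 1 + \<bar>int i - int j\<bar> \<le> int (length q)" if "i \<in> c v" "j \<in> c w" for v w i j
    using ex_tip_path[OF T, of i j] that unfolding c_def by fastforce
  have mem: "Min (c v) \<in> c v" "Max (c v) \<in> c v" "v < length cs" if "v \<in> M" for v
    using that fin_c Min_in[of "c v"] Max_in[of "c v"] by (auto simp: M_def)
  have gap: "2 + \<bar>int i - int j\<bar> \<le> int w - int v"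
    "2 + \<bar>int i - int j\<bar> \<le> int (length cs) - (int w - int v)"
    if vw: "v < w" "w < length cs" and ij: "i \<in> c v" "j \<in> c w" for v w i j
  proof -
    obtain q where q: "path_in W q" "q \<noteq> []" "E (cs ! v) (hd q)" "E (cs ! w) (last q)"
      and l: "1 + \<bar>int i - int j\<bar> \<le> int (length q)"
      using path[OF ij] by blast
    from bypass[OF q(1,2) vw q(3,4)] l vw
    show "2 + \<bar>int i - int j\<bar> \<le> int w - int v"
      "2 + \<bar>int i - int j\<bar> \<le> int (length cs) - (int w - int v)"
      by linarith+
  qed
  have "(\<Sum>v\<in>M. 2 + hi v - lo v) \<le> int (Max M) - int (Min M) + 2 + hi (Max M) - lo (Min M)"
  proof (rule sum_gaps_le[OF fin_M False])
    fix v w assume "v \<in> M" "w \<in> M" "v < w"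
    then show "2 + hi v - lo w \<le> int w - int v"
      using gap(1)[of v w "Max (c v)" "Min (c w)"] mem by (fastforce simp: lo_def hi_def)
  qed
  also have "\<dots> \<le> int (length cs)"
  \<comment> \<open>The gap from \<open>Max M\<close> across the closing edge to
    \<open>Min M\<close> is bounded by the second arc; if they coincide,
    \<open>detour_single\<close> takes its place.\<close>
  proof (cases "Min M < Max M")
    case True
    then show ?thesis
      using gap(2)[of "Min M" "Max M" "Min (c (Min M))" "Max (c (Max M))"]
        mem[OF Min_in[OF fin_M False]] mem[OF Max_in[OF fin_M False]]
      by (auto simp: lo_def hi_def)
  next
    case eq: False
    then have "Min M = Max M"
      using Min_le[OF fin_M Max_in[OF fin_M False]] by simp
    moreover obtain q where q: "path_in W q" "q \<noteq> []" "E (cs ! Max M) (hd q)" "E (cs ! Max M) (last q)"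
      and "1 + \<bar>int (Min (c (Max M))) - int (Max (c (Max M)))\<bar> \<le> int (length q)"
      using path mem(1,2)[OF Max_in[OF fin_M False]] by blast
    ultimately show ?thesis
      using detour_single[OF q(1,2) mem(3)[OF Max_in[OF fin_M False]] q(3,4)]
      by (simp add: lo_def hi_def)
  qed
  finally have "(\<Sum>v\<in>M. 2 + hi v - lo v) \<le> int (length cs)" .
  moreover have "(\<Sum>v\<in>M. 1 + int (card (c v))) \<le> (\<Sum>v\<in>M. 2 + hi v - lo v)"
  proof (rule sum_mono)
    fix v assume v: "v \<in> M"
    have "c v \<subseteq> {Min (c v)..Max (c v)}"
      using fin_c by auto
    then have "card (c v) \<le> card {Min (c v)..Max (c v)}"
      by (intro card_mono) auto
    moreover have "Min (c v) \<le> Max (c v)"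
      using mem[OF v] fin_c by simp
    ultimately show "1 + int (card (c v)) \<le> 2 + hi v - lo v"
      by (simp add: lo_def hi_def)
  qed
  ultimately show ?thesis
    by (simp add: sum.distrib flip: of_nat_sum)
qed simp

text \<open>With \<open>length xs\<close> equal to \<open>p + 1\<close>, the second factor is
  \<open>\<delta> - p\<close> cut off at 0.\<close>

theorem cycle_length_ge:
  assumes deg: "\<And>v. v \<in> W \<union> set cs \<Longrightarrow> \<delta> \<le> card {u \<in> W \<union> set cs. E v u}"
  shows "Suc (length xs) * (Suc \<delta> - length xs) \<le> length cs"
proof (cases "xs = []")
  case True
  have W: "W = {}"
  proof (rule ccontr)
    assume "W \<noteq> {}"
    then obtain u where "path_in W [u]"
      by (auto simp: path_in_def)
    from longest[OF this] show False
      using True by simp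
  qed
  have "cs \<noteq> []"
    using cyc_cs by (auto simp: cyc_def)
  then have hd: "hd cs \<in> set cs"
    by simp
  have "\<delta> \<le> card {u \<in> W \<union> set cs. E (hd cs) u}"
    using hd by (intro deg) simp
  also have "\<dots> \<le> card (set cs - {hd cs})"
    using irrefl W by (intro card_mono) auto
  also have "\<dots> = length cs - 1"
    using hd cyc_cs by (simp add: card_Diff_singleton distinct_card cyc_def)
  finally show ?thesis
    using \<open>cs \<noteq> []\<close> True by (cases cs) auto
next
  case False
  let ?P = "length xs"
  let ?L = "length cs"
  obtain T where T: "tails T" and max: "\<And>T'. tails T' \<Longrightarrow> weight T' \<le> weight T"
    using ex_max_tails by blast
  define c where "c v = {i. i < ?P \<and> E (cs ! v) (tip T i)}" for v
  define M where "M = {v. v < ?L \<and> c v \<noteq> {}}"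
  define D where "D = (\<Sum>v\<in>M. card (c v))"
  have LD: "card M + D \<le> ?L"
    using cycle_length_ge_attachments[OF T] by (simp add: c_def M_def D_def)
  have DM: "D \<le> card M * ?P"
  proof -
    have "card (c v) \<le> ?P" for v
      using card_mono[of "{..<?P}" "c v"] by (auto simp: c_def)
    then show ?thesis
      unfolding D_def using sum_bounded_above[of M "\<lambda>v. card (c v)" ?P] by simp
  qed
  have "D = (\<Sum>v<?L. card (c v))"
    unfolding D_def by (rule sum.mono_neutral_left) (auto simp: M_def)
  also have "\<dots> = (\<Sum>v<?L. card {i \<in> {..<?P}. E (cs ! v) (tip T i)})"
    by (simp add: c_def)
  also have "\<dots> = (\<Sum>i<?P. card {v \<in> {..<?L}. E (cs ! v) (tip T i)})"
    using sum.swap_restrict[of "{..<?L}" "{..<?P}" "\<lambda>_ _. 1::nat" "\<lambda>v i. E (cs ! v) (tip T i)"]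
    by simp
  finally have D: "D = (\<Sum>i<?P. card {v \<in> {..<?L}. E (cs ! v) (tip T i)})" .
  have "?P * \<delta> = (\<Sum>i<?P. \<delta>)"
    by simp
  also have "\<dots> \<le> (\<Sum>i<?P. card {v \<in> {..<?L}. E (cs ! v) (tip T i)} + card {u \<in> W. E (tip T i) u})"
  proof (rule sum_mono)
    fix i assume "i \<in> {..<?P}"
    then have "tip T i \<in> W"
      using tip_in_W[OF T] by simp
    then have "\<delta> \<le> card {u \<in> W \<union> set cs. E (tip T i) u}"
      by (intro deg) simp
    also have "\<dots> \<le> card ((\<lambda>v. cs ! v) ` {v \<in> {..<?L}. E (cs ! v) (tip T i)} \<union> {u \<in> W. E (tip T i) u})"
    proof (rule card_mono)
      show "finite ((\<lambda>v. cs ! v) ` {v \<in> {..<?L}. E (cs ! v) (tip T i)} \<union> {u \<in> W. E (tip T i) u})"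
        using finite_W by simp
      show "{u \<in> W \<union> set cs. E (tip T i) u}
          \<subseteq> (\<lambda>v. cs ! v) ` {v \<in> {..<?L}. E (cs ! v) (tip T i)} \<union> {u \<in> W. E (tip T i) u}"
        using sym by (auto simp: in_set_conv_nth)
    qed
    also have "\<dots> \<le> card ((\<lambda>v. cs ! v) ` {v \<in> {..<?L}. E (cs ! v) (tip T i)}) + card {u \<in> W. E (tip T i) u}"
      by (rule card_Un_le)
    also have "card ((\<lambda>v. cs ! v) ` {v \<in> {..<?L}. E (cs ! v) (tip T i)})
        \<le> card {v \<in> {..<?L}. E (cs ! v) (tip T i)}"
      by (rule card_image_le) simp
    finally show "\<delta> \<le> card {v \<in> {..<?L}. E (cs ! v) (tip T i)} + card {u \<in> W. E (tip T i) u}"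
      by simp
  qed
  also have "\<dots> = D + (\<Sum>i<?P. card {u \<in> W. E (tip T i) u})"
    by (simp add: sum.distrib D)
  also have "\<dots> \<le> D + ?P * (?P - 1)"
    using sum_card_nbrs_tips[OF T max] by simp
  finally have "?P * \<delta> \<le> D + ?P * (?P - 1)" .
  then have "?P * \<delta> - ?P * (?P - 1) \<le> D"
    by simp
  then have "?P * (\<delta> - (?P - 1)) \<le> D"
    by (simp add: diff_mult_distrib2)
  also have "\<delta> - (?P - 1) = Suc \<delta> - ?P"
    using False by (cases xs) auto
  finally have PD: "?P * (Suc \<delta> - ?P) \<le> D" .
  \<comment> \<open>The factor \<open>?P\<close> lets \<open>D \<le> card M * ?P\<close> eliminate
    \<open>card M\<close>: then \<open>D + ?P * D\<close> is at most
    \<open>?P * (card M + D)\<close>. It cancels in the end since \<open>xs\<close> is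
    nonempty.\<close>
  have "?P * (Suc ?P * (Suc \<delta> - ?P)) = Suc ?P * (?P * (Suc \<delta> - ?P))"
    by (simp only: ac_simps)
  also have "\<dots> \<le> Suc ?P * D"
    using PD by (rule mult_le_mono2)
  also have "\<dots> = D + ?P * D"
    by simp
  also have "\<dots> \<le> card M * ?P + ?P * D"
    using DM by simp
  also have "\<dots> = ?P * (card M + D)"
    by (simp add: distrib_left)
  also have "\<dots> \<le> ?P * ?L"
    using LD by (rule mult_le_mono2)
  finally show ?thesis
    using False by simp
qed

end

section \<open>Translation between arc walks and vertex lists\<close>

lemma (in wf_digraph) ex_awalk_of_vertices:
  assumes "q \<noteq> []" "set q \<subseteq> verts G" "successively (\<lambda>u v. (u, v) \<in> arcs_ends G) q"
  shows "\<exists>p. awalk (hd q) p (last q) \<and> awalk_verts (hd q) p = q"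
  using assms
proof (induction q rule: list_nonempty_induct)
  case (single u)
  then show ?case
    by (intro exI[of _ "[]"]) (simp add: awalk_Nil_iff)
next
  case (cons u q)
  then obtain p where p: "awalk (hd q) p (last q)" "awalk_verts (hd q) p = q"
    by (auto simp: successively_Cons)
  have "(u, hd q) \<in> arcs_ends G"
    using cons.hyps cons.prems by (simp add: successively_Cons)
  then obtain e where "e \<in> arcs G" "tail G e = u" "head G e = hd q"
    by (auto simp: arcs_ends_conv)
  then show ?case
    using p cons.hyps by (intro exI[of _ "e # p"]) (auto simp: awalk_Cons_iff)
qed

lemma (in wf_digraph) successively_awalk_verts:
  assumes "awalk u p v"
  shows "successively (\<lambda>u v. (u, v) \<in> arcs_ends G) (awalk_verts u p)"
  using assms
proof (induction p arbitrary: u)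
  case (Cons e p)
  then have "e \<in> arcs G" "awalk (head G e) p v"
    by (auto simp: awalk_Cons_iff)
  then show ?case
    using Cons.IH by (auto simp: successively_Cons arcs_ends_conv)
qed simp

lemma (in graph) sym_irrefl_arcs_ends: "sym_irrefl (\<lambda>u v. (u, v) \<in> arcs_ends G)"
proof
  show "(v, u) \<in> arcs_ends G" if "(u, v) \<in> arcs_ends G" for u v
    using that sym_arcs by (auto simp: symmetric_def dest: symD)
  show "(u, u) \<notin> arcs_ends G" for u
    using no_loops by (fastforce simp: arcs_ends_conv)
qed

lemma (in graph) cyc_map_tail:
  assumes "ucycle G C"
  shows "sym_irrefl.cyc (\<lambda>u v. (u, v) \<in> arcs_ends G) (map (tail G) C)"
proof -
  interpret sym_irrefl "\<lambda>u v. (u, v) \<in> arcs_ends G"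
    by (rule sym_irrefl_arcs_ends)
  obtain u where u: "awalk u C u" "distinct (tl (awalk_verts u C))" and C: "3 \<le> length C"
    using assms by (auto simp: ucycle_def cycle_def)
  have ne: "C \<noteq> []"
    using C by auto
  have "awalk_verts u C = map (tail G) C @ [head G (last C)]"
    using ne by (simp add: awalk_verts_conv)
  moreover have "awlast u C = u" "awhd u C = u"
    using u(1) by auto
  ultimately have verts: "awalk_verts u C = map (tail G) C @ [u]" and hd: "hd (map (tail G) C) = u"
    using ne by (auto simp: hd_append)
  \<comment> \<open>\<open>cycle\<close> demands distinctness of the vertex list without its first
    entry; its last entry is the start \<open>u\<close>, and moving that to the front gives the list
    of tails.\<close>
  have "distinct (tl (map (tail G) C) @ [u])"
    using u(2) ne by (simp add: verts)
  then have "distinct (hd (map (tail G) C) # tl (map (tail G) C))"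
    using hd by simp
  then have "distinct (map (tail G) C)"
    using ne by (metis list.collapse map_is_Nil_conv)
  moreover have "successively (\<lambda>u v. (u, v) \<in> arcs_ends G) (map (tail G) C @ [u])"
    using successively_awalk_verts[OF u(1)] by (simp add: verts)
  ultimately show ?thesis
    using C ne hd unfolding cyc_def successively_append_iff by simp
qed

lemma (in graph) ex_ucycle_of_cyc:
  assumes "sym_irrefl.cyc (\<lambda>u v. (u, v) \<in> arcs_ends G) q"
  shows "\<exists>D. ucycle G D \<and> length D = length q"
proof -
  interpret sym_irrefl "\<lambda>u v. (u, v) \<in> arcs_ends G"
    by (rule sym_irrefl_arcs_ends)
  have q: "distinct q" "3 \<le> length q" "successively (\<lambda>u v. (u, v) \<in> arcs_ends G) q"
    "(last q, hd q) \<in> arcs_ends G"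
    using assms by (auto simp: cyc_def)
  have ne: "q \<noteq> []"
    using q(2) by auto
  have succ: "successively (\<lambda>u v. (u, v) \<in> arcs_ends G) (q @ [hd q])"
    using q(3,4) by (simp add: successively_append_iff)
  \<comment> \<open>\<open>cyc\<close> does not mention \<open>verts G\<close>, but in the closed
    list each entry of \<open>q\<close> is the tail of an arc.\<close>
  have "set q \<subseteq> verts G"
  proof
    fix x assume "x \<in> set q"
    then obtain i where "i < length q" "x = (q @ [hd q]) ! i"
      by (auto simp: in_set_conv_nth nth_append)
    then have "(x, (q @ [hd q]) ! Suc i) \<in> arcs_ends G"
      using successively_nth[OF succ, of i] by simp
    then show "x \<in> verts G"
      by (auto simp: arcs_ends_conv)
  qed
  then have "set (q @ [hd q]) \<subseteq> verts G"
    using ne by auto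
  then obtain D where D: "awalk (hd q) D (hd q)" "awalk_verts (hd q) D = q @ [hd q]"
    using ex_awalk_of_vertices[of "q @ [hd q]"] succ ne by fastforce
  have "length D = length q"
    using D(2) length_awalk_verts[of "hd q" D] by simp
  moreover have "distinct (tl q @ [hd q])"
    using q(1) ne by (cases q) auto
  ultimately show ?thesis
    using D ne q(2) by (intro exI[of _ D]) (auto simp: ucycle_def cycle_def)
qed

lemma (in fin_digraph) ex_longest_path:
  "\<exists>xs. distinct xs \<and> set xs \<subseteq> verts G \<and> successively (\<lambda>u v. (u, v) \<in> arcs_ends G) xs
    \<and> int (length xs) = longest_path_length G + 1
    \<and> (\<forall>q. distinct q \<and> set q \<subseteq> verts G \<and> successively (\<lambda>u v. (u, v) \<in> arcs_ends G) q
        \<longrightarrow> length q \<le> length xs)"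
proof (cases "verts G = {}")
  \<comment> \<open>In the null graph the witness is \<open>[]\<close>, whose 0 vertices match the
    conventional length -1.\<close>
  case True
  then show ?thesis
    by (auto simp: longest_path_length_def)
next
  case False
  define A where "A = {length p | u p v. apath u p v}"
  have lpl: "longest_path_length G = int (Max A)"
    using False by (simp add: longest_path_length_def A_def)
  have "A \<subseteq> {..<card (verts G)}"
    using length_apath_less by (auto simp: A_def)
  then have fin: "finite A"
    using finite_subset by blast
  obtain w where "w \<in> verts G"
    using False by blast
  then have "apath w [] w"
    by (simp add: apath_Nil_iff)
  then have "A \<noteq> {}"
    unfolding A_def by blast
  then have "Max A \<in> A"
    by (rule Max_in[OF fin])
  then obtain u p v where p: "apath u p v" "length p = Max A"
    unfolding A_def by force
  then have walk: "awalk u p v" "distinct (awalk_verts u p)"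
    by (auto simp: apath_def)
  have "length q \<le> length (awalk_verts u p)"
    if q: "distinct q" "set q \<subseteq> verts G" "successively (\<lambda>u v. (u, v) \<in> arcs_ends G) q" for q
  proof (cases "q = []")
    case False
    then obtain r where r: "awalk (hd q) r (last q)" "awalk_verts (hd q) r = q"
      using ex_awalk_of_vertices[OF False q(2,3)] by blast
    then have "apath (hd q) r (last q)"
      using q by (simp add: apath_def)
    then have "length r \<in> A"
      unfolding A_def by blast
    then have "length r \<le> Max A"
      using fin by simp
    moreover have "length q = Suc (length r)"
      using r(2) length_awalk_verts[of "hd q" r] by simp
    ultimately show ?thesis
      by (simp add: length_awalk_verts p)
  qed simp
  moreover have "set (awalk_verts u p) \<subseteq> verts G"
    using walk(1) by auto
  ultimately show ?thesis
    using walk successively_awalk_verts[OF walk(1)] p lpl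
    by (intro exI[of _ "awalk_verts u p"]) (simp add: length_awalk_verts)
qed

section \<open>Degrees and the bound for the graph itself\<close>

text \<open>Without parallel arcs, \<open>head G\<close> is injective on the arcs leaving
  \<open>v\<close>, so counting these arcs counts neighbours.\<close>

lemma (in graph) min_degree_le:
  assumes "v \<in> verts G"
  shows "min_degree G \<le> card {u \<in> verts G. (v, u) \<in> arcs_ends G}"
proof -
  have "min_degree G \<le> out_degree G v"
    using assms by (simp add: min_degree_def)
  also have "\<dots> = card (head G ` out_arcs G v)"
    unfolding out_degree_def
    using no_multi_arcs by (intro card_image[symmetric] inj_onI) (auto simp: arc_to_ends_def)
  also have "\<dots> \<le> card {u \<in> verts G. (v, u) \<in> arcs_ends G}"
    by (intro card_mono) (auto simp: arcs_ends_conv)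
  finally show ?thesis .
qed

lemma (in graph) longest_cycle_length_ge:
  assumes C: "longest_cycle G C"
  defines "p \<equiv> longest_path_length (del_cycle G C)"
  shows "(p + 2) * (int (min_degree G) - p) \<le> int (length C)"
proof -
  let ?E = "\<lambda>u v. (u, v) \<in> arcs_ends G"
  let ?W = "verts G - tail G ` set C"
  let ?H = "del_cycle G C"
  interpret sym_irrefl ?E
    by (rule sym_irrefl_arcs_ends)
  interpret H: fin_digraph ?H
    unfolding del_cycle_def by (intro fin_digraph_subgraph induced_imp_subgraph induced_induce) simp
  have verts_H: "verts ?H = ?W"
    by (simp add: del_cycle_def)
  have arcs_H: "(u, v) \<in> arcs_ends ?H \<longleftrightarrow> ?E u v \<and> u \<in> ?W \<and> v \<in> ?W" for u v
    by (auto simp: del_cycle_def arcs_ends_conv induce_subgraph_def)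
  have path_H: "path_in ?W q \<longleftrightarrow>
      distinct q \<and> set q \<subseteq> verts ?H \<and> successively (\<lambda>u v. (u, v) \<in> arcs_ends ?H) q" for q
    unfolding path_in_def verts_H arcs_H by (auto elim!: successively_mono)
  obtain xs where xs: "path_in ?W xs" "int (length xs) = p + 1"
    "\<And>q. path_in ?W q \<Longrightarrow> length q \<le> length xs"
    using H.ex_longest_path unfolding path_H p_def by blast
  have uC: "ucycle G C"
    using C by (simp add: longest_cycle_def)
  interpret longest_cycle_path ?E ?W xs "map (tail G) C"
  proof
    show "cyc (map (tail G) C)"
      by (rule cyc_map_tail[OF uC])
    show "length q \<le> length (map (tail G) C)" if "cyc q" for q
      using ex_ucycle_of_cyc[OF that] C by (auto simp: longest_cycle_def)
  qed (use xs in auto)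
  have "set C \<subseteq> arcs G"
    using uC by (auto simp: ucycle_def cycle_def)
  then have V: "?W \<union> set (map (tail G) C) = verts G"
    by auto
  have "Suc (length xs) * (Suc (min_degree G) - length xs) \<le> length C"
    using cycle_length_ge[of "min_degree G"] min_degree_le unfolding V by simp
  then have le: "int (Suc (length xs)) * int (Suc (min_degree G) - length xs) \<le> int (length C)"
    by (metis of_nat_le_iff of_nat_mult)
  \<comment> \<open>If \<open>p\<close> exceeds the minimum degree, truncation raises the second
    factor to 0, so the integer product is still the smaller one.\<close>
  have "(p + 2) * (int (min_degree G) - p) \<le> int (Suc (length xs)) * int (Suc (min_degree G) - length xs)"
  proof -
    have "p + 2 = int (Suc (length xs))"
      using xs(2) by simp
    moreover have "int (min_degree G) - p \<le> int (Suc (min_degree G) - length xs)"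
      using xs(2) by linarith
    ultimately show ?thesis
      by (metis mult_left_mono of_nat_0_le_iff)
  qed
  then show ?thesis
    using le by linarith
qed

theorem theorem5:
  fixes G :: "('a, 'b) pre_digraph" and C :: "'b awalk" and l :: int
    and \<delta> :: nat and p :: int
  assumes "graph G"
    and "min_degree G = \<delta>"
    and "longest_cycle G C"
    and "longest_path_length (del_cycle G C) = p"
    and "min (l - 2) (int \<delta> - l) \<le> p"
    and "p \<le> max (l - 2) (int \<delta> - l)"
  shows "int (length C) \<ge> l * (int \<delta> - l + 2)"
proof -
  have "(p + 2) * (int \<delta> - p) \<le> int (length C)"
    using graph.longest_cycle_length_ge[OF assms(1,3)] assms(2,4) by simp
  \<comment> \<open>\<open>p\<close> lies between \<open>l - 2\<close> and
    \<open>\<delta> - l\<close>, in whichever order, so the two factors never have opposite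
    signs.\<close>
  moreover have "0 \<le> (p - (l - 2)) * (int \<delta> - l - p)"
    using assms(5,6) by (auto simp: zero_le_mult_iff min_def max_def split: if_splits)
  moreover have "(p - (l - 2)) * (int \<delta> - l - p) = (p + 2) * (int \<delta> - p) - l * (int \<delta> - l + 2)"
    by (simp add: algebra_simps)
  ultimately show ?thesis
    by linarith
qed

end
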